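(* Let $q\in(0,1]$, $s>0$, and consider the ReLU network with dropout $x^{(k+1)}=\phi_0(W^{(k+1)}x^{(k)})\odot\varepsilon^{(k+1)}$. Define $$q_d(n)=\binom dn\Big(\frac q2\Big)^n\Big(1-\frac q2\Big)^{d-n},\qquad I_{0,q}(s,d)=\frac{2^{s/2}}{q^s}\sum_{n=1}^dq_d(n)\frac{\Gamma(n/2+s/2)}{\Gamma(n/2)}.$$ Then $\mathbb E\|x^{(k)}\|^s=\|x^{(0)}\|^s(\sigma^sI_{0,q}(s,d))^k$ for all $k\ge0$. With $\bar\sigma_{0,q}(s,d)=I_{0,q}(s,d)^{-1/s}$ and $x^{(0)}\neq0$: (i) if $\sigma=\bar\sigma_{0,q}(s,d)$ then $\mathbb E\|x^{(k)}\|^s=\|x^{(0)}\|^s$ for all $k\ge1$ while $\mathbb E\|x^{(k)}\|^p\to\infty$ exponentially fast for every $p>s$; (ii) if $\sigma<\bar\sigma_{0,q}(s,d)$ then $\mathbb E\|x^{(k)}\|^s\to0$ exponentially fast; (iii) if $\sigma>\bar\sigma_{0,q}(s,d)$ then $\mathbb E\|x^{(k)}\|^s\to\infty$ exponentially fast.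
   Context: $d\ge1$ is the width; $\phi_0(z)=\max(z,0)$ applied componentwise; $\sigma>0$; $x^{(0)}\in\mathbb R^d$ is deterministic; the matrices $W^{(1)},W^{(2)},\dots\in\mathbb R^{d\times d}$ have i.i.d. $\mathcal N(0,\sigma^2)$ entries; the dropout vectors $\varepsilon^{(1)},\varepsilon^{(2)},\dots\in\mathbb R^d$ are independent of the weights and have i.i.d. components with $\mathbb P(\varepsilon_i^{(k)}=0)=1-q$ and $\mathbb P(\varepsilon_i^{(k)}=1/q)=q$; $\odot$ is componentwise multiplication; $\|\cdot\|$ is the Euclidean norm. *)

theory Defs
  imports "HOL-Probability.Probability"
begin

definition relu :: "real \<Rightarrow> real" where
  "relu z = max z 0"

definition gauss_entry :: "real \<Rightarrow> real measure" where
  "gauss_entry \<sigma> = density lborel (normal_density 0 \<sigma>)"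

definition dropout_entry :: "real \<Rightarrow> real measure" where
  "dropout_entry q = measure_pmf (map_pmf (\<lambda>b. if b then 1 / q else 0) (bernoulli_pmf q))"

definition layer_space :: "real \<Rightarrow> real \<Rightarrow> (('d::finite \<times> 'd \<Rightarrow> real) \<times> ('d \<Rightarrow> real)) measure" where
  "layer_space \<sigma> q = (PiM UNIV (\<lambda>_. gauss_entry \<sigma>)) \<Otimes>\<^sub>M (PiM UNIV (\<lambda>_. dropout_entry q))"

text \<open>The whole network randomness: component k is (W^(k+1), eps^(k+1)); all independent.\<close>
definition net_space :: "real \<Rightarrow> real \<Rightarrow> (nat \<Rightarrow> ('d::finite \<times> 'd \<Rightarrow> real) \<times> ('d \<Rightarrow> real)) measure" where
  "net_space \<sigma> q = PiM (UNIV :: nat set) (\<lambda>_. layer_space \<sigma> q)"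

fun net_state :: "real^'d::finite \<Rightarrow> (nat \<Rightarrow> ('d \<times> 'd \<Rightarrow> real) \<times> ('d \<Rightarrow> real)) \<Rightarrow> nat \<Rightarrow> real^'d" where
  "net_state x0 \<omega> 0 = x0"
| "net_state x0 \<omega> (Suc k) =
     (\<chi> i. relu (\<Sum>j\<in>UNIV. fst (\<omega> k) (i, j) * net_state x0 \<omega> k $ j) * snd (\<omega> k) i)"

definition moment :: "real \<Rightarrow> real \<Rightarrow> real^'d::finite \<Rightarrow> real \<Rightarrow> nat \<Rightarrow> ennreal" where
  "moment \<sigma> q x0 s k = (\<integral>\<^sup>+ \<omega>. ennreal (norm (net_state x0 \<omega> k) powr s) \<partial>(net_space \<sigma> q))"

definition qd :: "nat \<Rightarrow> real \<Rightarrow> nat \<Rightarrow> real" where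
  "qd d q n = real (d choose n) * (q / 2) ^ n * (1 - q / 2) ^ (d - n)"

definition I0q :: "real \<Rightarrow> real \<Rightarrow> nat \<Rightarrow> real" where
  "I0q q s d = 2 powr (s / 2) / q powr s *
     (\<Sum>n = 1..d. qd d q n * Gamma (real n / 2 + s / 2) / Gamma (real n / 2))"

definition sigma_bar :: "real \<Rightarrow> real \<Rightarrow> nat \<Rightarrow> real" where
  "sigma_bar q s d = I0q q s d powr (- 1 / s)"

end

theory Submission
  imports Defs
begin

text \<open>
  For a fixed nonzero input \<open>x\<close> the pre-activations of a layer are i.i.d. centred Gaussians with
  standard deviation \<open>\<sigma> \<parallel>x\<parallel>\<close>, so each coordinate survives ReLU and dropout with probability
  \<open>q/2\<close>, and half the normalised square of a surviving coordinate is \<open>Gamma(1/2)\<close> distributed.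
  Since Gamma laws with equal rate add up, the squared norm of the output is a binomial mixture of
  Gamma laws with shapes \<open>n/2\<close>, whose fractional moments give \<open>I0q\<close>. As the result depends on
  \<open>x\<close> only through its norm, peeling off the first layer yields the geometric formula for the
  moments. At the critical variance, higher moments grow by a strict Lyapunov inequality, strict
  because the layer output vanishes with positive probability.
\<close>

subsection \<open>Gamma laws\<close>

definition gamma_density :: "real \<Rightarrow> real \<Rightarrow> real" where
  "gamma_density a x = indicator {0..} x * x powr (a - 1) * exp (- x) / Gamma a"

text \<open>Shape 0 stands for the point mass at zero. This gives the convolution semigroup its
  neutral element and covers layer outputs without any active coordinate.\<close>

definition gamma_law :: "real \<Rightarrow> real measure" where
  "gamma_law a = (if a = 0 then return borel 0 else density lborel (gamma_density a))"

lemma gamma_density_nonneg: "0 < a \<Longrightarrow> 0 \<le> gamma_density a x"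
  by (simp add: gamma_density_def Gamma_real_pos less_imp_le)

lemma borel_measurable_gamma_density [measurable]: "gamma_density a \<in> borel_measurable borel"
  unfolding gamma_density_def by measurable

lemma sets_gamma_law [measurable_cong, simp]: "sets (gamma_law a) = sets borel"
  by (simp add: gamma_law_def)

lemma nn_integral_gamma_law:
  assumes "0 < a" and [measurable]: "F \<in> borel_measurable borel"
  shows "(\<integral>\<^sup>+x. F x \<partial>gamma_law a) = (\<integral>\<^sup>+x. ennreal (gamma_density a x) * F x \<partial>lborel)"
  using assms(1) by (simp add: gamma_law_def nn_integral_density)

lemma nn_integral_gamma_law_0:
  assumes "F \<in> borel_measurable borel"
  shows "(\<integral>\<^sup>+x. F x \<partial>gamma_law 0) = F 0"
  using assms by (simp add: gamma_law_def nn_integral_return)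

text \<open>Up to the factor \<open>1 / Gamma a\<close>, the integrand against Lebesgue measure is
  Euler's integrand for \<open>Gamma (a + t)\<close>.\<close>

lemma nn_integral_gamma_law_powr:
  assumes a: "0 < a" and t: "0 \<le> t"
  shows "(\<integral>\<^sup>+x. ennreal (x powr t) \<partial>gamma_law a) = ennreal (Gamma (a + t) / Gamma a)"
proof -
  have "(\<integral>\<^sup>+x. ennreal (x powr t) \<partial>gamma_law a) =
      (\<integral>\<^sup>+x. ennreal (1 / Gamma a) * ennreal (indicator {0..} x * x powr (a + t - 1) / exp x) \<partial>lborel)"
    using a gamma_density_nonneg[OF a]
    by (auto simp: nn_integral_gamma_law ennreal_mult' [symmetric] gamma_density_def indicator_def
        exp_minus field_simps powr_add [symmetric] Gamma_real_pos less_imp_le intro!: nn_integral_cong)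
  also have "\<dots> = ennreal (1 / Gamma a) * ennreal (Gamma (a + t))"
    using a t by (subst nn_integral_cmult) (auto simp: Gamma_conv_nn_integral_real)
  finally show ?thesis
    using a t by (simp add: ennreal_mult' [symmetric] Gamma_real_pos less_imp_le)
qed

lemma prob_space_gamma_law:
  assumes "0 \<le> a"
  shows "prob_space (gamma_law a)"
proof (cases "a = 0")
  case True
  then show ?thesis by (simp add: gamma_law_def prob_space_return)
next
  case False
  with assms have a: "0 < a" by simp
  \<comment> \<open>At \<open>x = 0\<close> the value of \<open>x powr 0\<close> is 0 rather than 1,
    but the density vanishes there too because \<open>0 powr (a - 1) = 0\<close>. The weighted
    integrands therefore agree everywhere.\<close>
  have "(\<integral>\<^sup>+x. 1 \<partial>gamma_law a) = (\<integral>\<^sup>+x. ennreal (x powr 0) \<partial>gamma_law a)"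
    unfolding nn_integral_gamma_law[OF a borel_measurable_const]
    by (subst nn_integral_gamma_law[OF a])
      (auto simp: gamma_density_def indicator_def intro!: nn_integral_cong)
  also have "\<dots> = 1"
    using a by (subst nn_integral_gamma_law_powr) (auto simp: Gamma_eq_zero_iff dest: nonpos_Ints_nonpos)
  finally show ?thesis
    by (intro prob_spaceI) simp
qed

text \<open>The substitution \<open>x = z * t\<close> factors out
  \<open>z powr (a + b - 1) * exp (- z)\<close> and leaves the Beta integral, whose value is
  \<open>Gamma a * Gamma b / Gamma (a + b)\<close>. For \<open>z \<le> 0\<close> both sides vanish,
  the density being 0 at the origin.\<close>

lemma gamma_density_convolution:
  assumes a: "0 < a" and b: "0 < b"
  shows "(\<integral>\<^sup>+x. ennreal (gamma_density a x * gamma_density b (z - x)) \<partial>lborel) =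
    ennreal (gamma_density (a + b) z)"
proof (cases "0 < z")
  case False
  then have "gamma_density a x * gamma_density b (z - x) = 0" for x
    by (cases "x = 0") (auto simp: gamma_density_def indicator_def)
  moreover have "gamma_density (a + b) z = 0"
    using False by (auto simp: gamma_density_def indicator_def)
  ultimately show ?thesis by (simp only: ennreal_0 nn_integral_const mult_zero_left)
next
  case z: True
  have pos: "0 < Gamma a" "0 < Gamma b" "0 < Gamma (a + b)"
    using a b by (auto intro: Gamma_real_pos)
  let ?c = "z powr (a + b - 2) * exp (- z) / (Gamma a * Gamma b)"
  have "(\<integral>\<^sup>+x. ennreal (gamma_density a x * gamma_density b (z - x)) \<partial>lborel) =
      ennreal z * (\<integral>\<^sup>+t. ennreal (gamma_density a (z * t) * gamma_density b (z - z * t)) \<partial>lborel)"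
    using z by (subst nn_integral_real_affine[where c = z and t = 0]) auto
  also have "\<dots> = ennreal z * (\<integral>\<^sup>+t. ennreal ?c *
      (ennreal (t powr (a - 1) * (1 - t) powr (b - 1)) * indicator {0..1} t) \<partial>lborel)"
  proof (intro arg_cong2[where f = "(*)"] refl nn_integral_cong)
    fix t :: real
    have *: "z - z * t = z * (1 - t)" by (simp add: algebra_simps)
    have "gamma_density a (z * t) * gamma_density b (z * (1 - t)) =
        ?c * (t powr (a - 1) * (1 - t) powr (b - 1) * indicator {0..1} t)"
    proof (cases "0 \<le> t \<and> t \<le> 1")
      case True
      have e: "exp (- (z * t)) * exp (- (z * (1 - t))) = exp (- z)"
        by (simp add: exp_add [symmetric] algebra_simps)
      have p: "z powr (a - 1) * z powr (b - 1) = z powr (a + b - 2)"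
        by (simp add: powr_add [symmetric])
      have "gamma_density a (z * t) * gamma_density b (z * (1 - t)) =
          (z powr (a - 1) * z powr (b - 1)) * (exp (- (z * t)) * exp (- (z * (1 - t)))) / (Gamma a * Gamma b) *
          (t powr (a - 1) * (1 - t) powr (b - 1))"
        using True z by (simp add: gamma_density_def powr_mult)
      then show ?thesis using True unfolding e p by simp
    next
      case False
      then show ?thesis using z by (auto simp: gamma_density_def zero_le_mult_iff)
    qed
    then show "ennreal (gamma_density a (z * t) * gamma_density b (z - z * t)) = ennreal ?c *
      (ennreal (t powr (a - 1) * (1 - t) powr (b - 1)) * indicator {0..1} t)"
      using pos unfolding * by (auto simp: ennreal_mult' [symmetric] indicator_def)
  qed
  also have "\<dots> = ennreal z * (ennreal ?c * ennreal (Beta a b))"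
    using nn_integral_has_integral_lebesgue[OF _ has_integral_Beta_real[OF a b]]
    by (subst nn_integral_cmult) (auto simp: ennreal_mult' ennreal_indicator mult_ac)
  also have "\<dots> = ennreal (z * (?c * Beta a b))"
    using z pos by (simp add: ennreal_mult' [symmetric] Beta_def)
  also have "z * (?c * Beta a b) = gamma_density (a + b) z"
  proof -
    have "z * z powr (a + b - 2) = z powr (a + b - 1)"
      using z by (simp add: powr_mult_base)
    then show ?thesis
      using z pos by (simp add: gamma_density_def Beta_def)
  qed
  finally show ?thesis .
qed

text \<open>For positive shapes, translating the inner variable and exchanging the integrals
  produces the convolution of the two densities. A summand of shape 0 is a shift by zero.\<close>

lemma nn_integral_gamma_law_add:
  assumes a: "0 \<le> a" and b: "0 \<le> b" and [measurable]: "F \<in> borel_measurable borel"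
  shows "(\<integral>\<^sup>+x. \<integral>\<^sup>+y. F (x + y) \<partial>gamma_law b \<partial>gamma_law a) = (\<integral>\<^sup>+z. F z \<partial>gamma_law (a + b))"
proof -
  interpret b: prob_space "gamma_law b" by (rule prob_space_gamma_law) fact
  consider "a = 0" | "b = 0" | "0 < a" "0 < b" using a b by linarith
  then show ?thesis
  proof cases
    case 1
    then show ?thesis by (subst nn_integral_gamma_law_0[of "\<lambda>x. \<integral>\<^sup>+y. F (x + y) \<partial>gamma_law b", folded 1]) auto
  next
    case 2
    have "(\<integral>\<^sup>+y. F (x + y) \<partial>gamma_law b) = F x" for x
      using 2 by (simp add: nn_integral_gamma_law_0)
    then show ?thesis using 2 by simp
  next
    case 3
    have "(\<integral>\<^sup>+x. \<integral>\<^sup>+y. F (x + y) \<partial>gamma_law b \<partial>gamma_law a) =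
        (\<integral>\<^sup>+x. ennreal (gamma_density a x) * (\<integral>\<^sup>+y. ennreal (gamma_density b y) * F (x + y) \<partial>lborel) \<partial>lborel)"
      using 3 by (simp add: nn_integral_gamma_law)
    also have "\<dots> = (\<integral>\<^sup>+x. ennreal (gamma_density a x) *
        (\<integral>\<^sup>+z. ennreal (gamma_density b (z - x)) * F z \<partial>lborel) \<partial>lborel)"
    proof (rule nn_integral_cong, rule arg_cong2[where f = "(*)", OF refl])
      fix x
      show "(\<integral>\<^sup>+y. ennreal (gamma_density b y) * F (x + y) \<partial>lborel) =
          (\<integral>\<^sup>+z. ennreal (gamma_density b (z - x)) * F z \<partial>lborel)"
        by (subst nn_integral_real_affine[where c = 1 and t = "- x"]) auto
    qed
    also have "\<dots> = (\<integral>\<^sup>+x. \<integral>\<^sup>+z. ennreal (gamma_density a x * gamma_density b (z - x)) * F z \<partial>lborel \<partial>lborel)"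
      using 3 by (simp add: nn_integral_cmult [symmetric] ennreal_mult' gamma_density_nonneg mult.assoc)
    also have "\<dots> = (\<integral>\<^sup>+z. \<integral>\<^sup>+x. ennreal (gamma_density a x * gamma_density b (z - x)) * F z \<partial>lborel \<partial>lborel)"
      by (rule lborel_pair.Fubini') simp
    also have "\<dots> = (\<integral>\<^sup>+z. ennreal (gamma_density (a + b) z) * F z \<partial>lborel)"
      using 3 by (simp add: nn_integral_multc gamma_density_convolution)
    finally show ?thesis using 3 by (simp add: nn_integral_gamma_law)
  qed
qed

section \<open>Half squares of rectified Gaussians\<close>

lemma nn_integral_atLeast_0_SUP:
  fixes f :: "real \<Rightarrow> ennreal" and b :: "nat \<Rightarrow> real"
  assumes [measurable]: "f \<in> borel_measurable borel"
    and b: "incseq b" "\<And>x. \<exists>n. x \<le> b n"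
  shows "(\<integral>\<^sup>+x. f x * indicator {0..} x \<partial>lborel) = (SUP n. \<integral>\<^sup>+x. f x * indicator {0..b n} x \<partial>lborel)"
proof -
  have "f x * indicator {0..} x = (SUP n. f x * indicator {0..b n} x)" for x
  proof (rule antisym)
    obtain n where "x \<le> b n" using b(2) by blast
    then have "f x * indicator {0..} x \<le> f x * indicator {0..b n} x"
      by (auto simp: indicator_def)
    then show "f x * indicator {0..} x \<le> (SUP n. f x * indicator {0..b n} x)"
      by (rule SUP_upper2[OF UNIV_I])
  qed (auto simp: indicator_def intro!: SUP_least)
  then have "(\<integral>\<^sup>+x. f x * indicator {0..} x \<partial>lborel) = (\<integral>\<^sup>+x. (SUP n. f x * indicator {0..b n} x) \<partial>lborel)"
    by simp
  also have "\<dots> = (SUP n. \<integral>\<^sup>+x. f x * indicator {0..b n} x \<partial>lborel)"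
  proof (rule nn_integral_monotone_convergence_SUP)
    show "incseq (\<lambda>n x. f x * indicator {0..b n} x)"
      using b(1) by (force simp: incseq_def le_fun_def indicator_def dest: order_trans)
  qed simp
  finally show ?thesis .
qed

text \<open>Change of variables \<open>x = u\<^sup>2 / 2\<close> with Jacobian \<open>u\<close>,
  carried out on compact intervals and passed to the half-line by monotone convergence.\<close>

lemma nn_integral_half_square_substitution:
  assumes [measurable]: "f \<in> borel_measurable borel"
  shows "(\<integral>\<^sup>+x. f x * indicator {0..} x \<partial>lborel) =
    (\<integral>\<^sup>+u. f (u\<^sup>2 / 2) * ennreal u * indicator {0..} u \<partial>lborel)"
proof -
  \<comment> \<open>The right endpoints are the images of \<open>real (Suc n)\<close> under the
    substitution, so both exhaustions match term by term; \<open>Suc n\<close> keeps every interval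
    nondegenerate.\<close>
  have "(\<integral>\<^sup>+x. f x * indicator {0..} x \<partial>lborel) =
      (SUP n. \<integral>\<^sup>+x. f x * indicator {0..(real (Suc n))\<^sup>2 / 2} x \<partial>lborel)"
  proof (rule nn_integral_atLeast_0_SUP)
    show "incseq (\<lambda>n. (real (Suc n))\<^sup>2 / 2)"
      by (auto simp: incseq_def intro!: power_mono)
    show "\<exists>n. x \<le> (real (Suc n))\<^sup>2 / 2" for x
    proof -
      obtain n where "2 * x \<le> real n" using real_arch_simple by blast
      also have "real n \<le> (real (Suc n))\<^sup>2" by (simp add: power2_eq_square algebra_simps)
      finally show ?thesis by (intro exI[of _ n]) simp
    qed
  qed simp
  also have "\<dots> = (SUP n. \<integral>\<^sup>+u. f (u\<^sup>2 / 2) * ennreal u * indicator {0..real (Suc n)} u \<partial>lborel)"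
  proof -
    have deriv: "((\<lambda>u. u\<^sup>2 / 2) has_real_derivative u) (at u)" for u :: real
      by (auto intro!: derivative_eq_intros)
    have "(\<integral>\<^sup>+x. f x * indicator {0..(real (Suc n))\<^sup>2 / 2} x \<partial>lborel) =
        (\<integral>\<^sup>+u. f (u\<^sup>2 / 2) * ennreal u * indicator {0..real (Suc n)} u \<partial>lborel)" for n
      using nn_integral_substitution_aux[of f 0 "real (Suc n)" "\<lambda>u. u\<^sup>2 / 2" "\<lambda>u. u",
          OF assms _ deriv continuous_on_id]
      by (simp del: of_nat_Suc)
    then show ?thesis by (rule SUP_cong[OF refl])
  qed
  also have "\<dots> = (\<integral>\<^sup>+u. f (u\<^sup>2 / 2) * ennreal u * indicator {0..} u \<partial>lborel)"
  proof (rule nn_integral_atLeast_0_SUP[of "\<lambda>u. f (u\<^sup>2 / 2) * ennreal u" "\<lambda>n. real (Suc n)", symmetric])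
    show "incseq (\<lambda>n. real (Suc n))" by (simp add: incseq_def)
    show "\<exists>n. x \<le> real (Suc n)" for x
    proof -
      obtain n where "x \<le> real n" using real_arch_simple by blast
      then show ?thesis by (intro exI[of _ n]) simp
    qed
  qed measurable
  finally show ?thesis .
qed

text \<open>On the positive half-line, \<open>gamma_density (1 / 2) (u\<^sup>2 / 2) / 2\<close>
  times the Jacobian \<open>u\<close> is the standard normal density, because
  \<open>Gamma (1 / 2) = sqrt pi\<close>. The factor 1/2 is the Gaussian mass of that
  half-line.\<close>

lemma nn_integral_gaussian_positive_half:
  assumes [measurable]: "F \<in> borel_measurable borel"
  shows "(\<integral>\<^sup>+u. ennreal (std_normal_density u) * (F (u\<^sup>2 / 2) * indicator {0..} u) \<partial>lborel) =
    ennreal (1 / 2) * (\<integral>\<^sup>+x. F x \<partial>gamma_law (1 / 2))"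
proof -
  have "ennreal (1 / 2) * (\<integral>\<^sup>+x. F x \<partial>gamma_law (1 / 2)) =
      (\<integral>\<^sup>+x. (ennreal (gamma_density (1 / 2) x / 2) * F x) * indicator {0..} x \<partial>lborel)"
  proof -
    have "ennreal (1 / 2) * (ennreal (gamma_density (1 / 2) x) * F x) =
        (ennreal (gamma_density (1 / 2) x / 2) * F x) * indicator {0..} x" for x
      unfolding mult.assoc [symmetric] ennreal_mult' [symmetric, OF zero_le_divide_1_iff [THEN iffD2, OF zero_le_numeral]]
      by (auto simp: gamma_density_def indicator_def mult.commute)
    then show ?thesis
      by (simp add: nn_integral_gamma_law nn_integral_cmult [symmetric] del: ennreal_half)
  qed
  also have "\<dots> = (\<integral>\<^sup>+u. (ennreal (gamma_density (1 / 2) (u\<^sup>2 / 2) / 2) * F (u\<^sup>2 / 2)) * ennreal u *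
      indicator {0..} u \<partial>lborel)"
    by (rule nn_integral_half_square_substitution) simp
  also have "\<dots> = (\<integral>\<^sup>+u. ennreal (std_normal_density u) * (F (u\<^sup>2 / 2) * indicator {0..} u) \<partial>lborel)"
  \<comment> \<open>The point \<open>u = 0\<close> has to be discarded: there the left integrand is
    0, whereas the normal density is positive.\<close>
  proof (intro nn_integral_cong_AE eventually_mono[OF AE_lborel_singleton[of 0]])
    fix u :: real assume "u \<noteq> 0"
    show "(ennreal (gamma_density (1 / 2) (u\<^sup>2 / 2) / 2) * F (u\<^sup>2 / 2)) * ennreal u * indicator {0..} u =
      ennreal (std_normal_density u) * (F (u\<^sup>2 / 2) * indicator {0..} u)"
    proof (cases "0 \<le> u")
      case True
      with \<open>u \<noteq> 0\<close> have u: "0 < u" by simp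
      have p: "(u\<^sup>2 / 2) powr - (1 / 2) = sqrt 2 / u"
        using u by (simp add: powr_minus powr_half_sqrt real_sqrt_divide field_simps)
      have "gamma_density (1 / 2) (u\<^sup>2 / 2) / 2 * u = std_normal_density u"
        using u by (simp add: gamma_density_def p Gamma_one_half_real std_normal_density_def
            real_sqrt_mult field_simps)
      then have "ennreal (std_normal_density u) = ennreal (gamma_density (1 / 2) (u\<^sup>2 / 2) / 2) * ennreal u"
        using u by (simp add: ennreal_mult' [symmetric] gamma_density_nonneg)
      then show ?thesis by (simp only: mult_ac)
    qed simp
  qed
  finally show ?thesis ..
qed

lemma nn_integral_gaussian_relu:
  assumes [measurable]: "F \<in> borel_measurable borel"
  shows "(\<integral>\<^sup>+u. F ((relu u)\<^sup>2 / 2) \<partial>gauss_entry 1) =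
    ennreal (1 / 2) * F 0 + ennreal (1 / 2) * (\<integral>\<^sup>+x. F x \<partial>gamma_law (1 / 2))"
proof -
  let ?\<phi> = "\<lambda>u. ennreal (std_normal_density u)"
  interpret g: prob_space "gamma_law (1 / 2)" by (rule prob_space_gamma_law) simp
  interpret N: prob_space "density lborel ?\<phi>" by (rule prob_space_normal_density) simp
  have split: "(\<integral>\<^sup>+u. ?\<phi> u * G ((relu u)\<^sup>2 / 2) \<partial>lborel) =
      (\<integral>\<^sup>+u. ?\<phi> u * indicator {..<0} u \<partial>lborel) * G 0 + ennreal (1 / 2) * (\<integral>\<^sup>+x. G x \<partial>gamma_law (1 / 2))"
    if [measurable]: "G \<in> borel_measurable borel" for G :: "real \<Rightarrow> ennreal"
  proof -
    have "(\<integral>\<^sup>+u. ?\<phi> u * G ((relu u)\<^sup>2 / 2) \<partial>lborel) =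
        (\<integral>\<^sup>+u. ?\<phi> u * indicator {..<0} u * G 0 + ?\<phi> u * (G (u\<^sup>2 / 2) * indicator {0..} u) \<partial>lborel)"
      by (intro nn_integral_cong) (auto simp: relu_def indicator_def)
    then show ?thesis
      by (simp add: nn_integral_add nn_integral_multc nn_integral_gaussian_positive_half)
  qed
  \<comment> \<open>Testing \<open>split\<close> with the constant 1 determines the mass of the
    negative half-line: the total is 1 and the positive half takes 1/2.\<close>
  have "(\<integral>\<^sup>+u. ?\<phi> u \<partial>lborel) = 1"
    using N.emeasure_space_1 by (simp add: emeasure_density)
  with split[of "\<lambda>_. 1"] g.emeasure_space_1
  have "ennreal (1 / 2) + (\<integral>\<^sup>+u. ?\<phi> u * indicator {..<0} u \<partial>lborel) = 1"
    by (simp add: add.commute)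
  also have "1 = ennreal (1 / 2) + ennreal (1 / 2)"
    by (subst ennreal_plus [symmetric]) auto
  finally have "(\<integral>\<^sup>+u. ?\<phi> u * indicator {..<0} u \<partial>lborel) = ennreal (1 / 2)"
    unfolding ennreal_add_left_cancel by auto
  with split[of F] show ?thesis
    by (simp add: gauss_entry_def nn_integral_density relu_def)
qed

subsection \<open>Rectified Gaussians with dropout\<close>

lemma prob_space_gauss_entry: "0 < \<sigma> \<Longrightarrow> prob_space (gauss_entry \<sigma>)"
  unfolding gauss_entry_def by (rule prob_space_normal_density)

lemma sets_gauss_entry [measurable_cong, simp]: "sets (gauss_entry \<sigma>) = sets borel"
  by (simp add: gauss_entry_def)

lemma space_gauss_entry [simp]: "space (gauss_entry \<sigma>) = UNIV"
  by (simp add: gauss_entry_def)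

lemma prob_space_dropout_entry: "prob_space (dropout_entry q)"
  unfolding dropout_entry_def by (rule prob_space_measure_pmf)

text \<open>The dropout measure comes from a pmf, so its sigma-algebra is the full power set and not
  the Borel one. Measurability of coordinates in products is therefore derived by composing with a
  projection.\<close>

lemma measurable_dropout_entry [simp]: "f \<in> borel_measurable (dropout_entry q)"
  by (simp add: dropout_entry_def)

lemma measurable_dropout_component:
  "i \<in> I \<Longrightarrow> (\<lambda>\<omega>. \<omega> i :: real) \<in> borel_measurable (PiM I (\<lambda>_. dropout_entry q))"
  by (rule measurable_compose[OF measurable_component_singleton]) auto

lemma measurable_dropout_fst:
  "i \<in> I \<Longrightarrow> (\<lambda>p. fst p i :: real) \<in> borel_measurable (PiM I (\<lambda>_. dropout_entry q) \<Otimes>\<^sub>M M)"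
  by (rule measurable_compose[OF measurable_fst measurable_dropout_component])

lemma measurable_gauss_snd:
  "i \<in> I \<Longrightarrow> (\<lambda>p. snd p i :: real) \<in> borel_measurable (M \<Otimes>\<^sub>M PiM I (\<lambda>_. gauss_entry \<sigma>))"
  by measurable

lemma borel_measurable_relu [measurable]: "relu \<in> borel_measurable borel"
  unfolding relu_def by measurable

lemma nn_integral_pmf_swap:
  assumes fin: "finite (set_pmf p)" and [measurable]: "\<And>n. f n \<in> borel_measurable M"
  shows "(\<integral>\<^sup>+x. \<integral>\<^sup>+n. f n x \<partial>measure_pmf p \<partial>M) = (\<integral>\<^sup>+n. \<integral>\<^sup>+x. f n x \<partial>M \<partial>measure_pmf p)"
  by (simp add: nn_integral_measure_pmf_finite[OF fin] nn_integral_sum nn_integral_multc)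

text \<open>The factor \<open>q\<close> turns the dropout values \<open>0\<close>, \<open>1/q\<close> into \<open>0\<close>, \<open>1\<close>; halving the square makes
  it an exact \<open>Gamma(1/2)\<close> variable on the event that the coordinate is active.\<close>
definition masked_half_square :: "real \<Rightarrow> real \<Rightarrow> real \<Rightarrow> real" where
  "masked_half_square q u e = (relu u * (q * e))\<^sup>2 / 2"

lemma measurable_masked_half_square [measurable]:
  assumes [measurable]: "f \<in> borel_measurable M" "g \<in> borel_measurable M"
  shows "(\<lambda>x. masked_half_square q (f x) (g x)) \<in> borel_measurable M"
  unfolding masked_half_square_def by measurable

text \<open>A coordinate is active when the Gaussian is positive and dropout keeps it, two
  independent events of probabilities 1/2 and \<open>q\<close>. The inactive mass
  \<open>q / 2 + (1 - q)\<close> goes to shape 0.\<close>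

lemma nn_integral_masked_half_square:
  assumes q: "0 < q" "q \<le> 1" and G [measurable]: "G \<in> borel_measurable borel"
  shows "(\<integral>\<^sup>+e. \<integral>\<^sup>+u. G (masked_half_square q u e) \<partial>gauss_entry 1 \<partial>dropout_entry q) =
    (\<integral>\<^sup>+b. \<integral>\<^sup>+x. G x \<partial>gamma_law ((if b then 1 else 0) / 2) \<partial>measure_pmf (bernoulli_pmf (q / 2)))"
proof -
  interpret N: prob_space "gauss_entry 1" by (rule prob_space_gauss_entry) simp
  let ?g = "\<integral>\<^sup>+x. G x \<partial>gamma_law (1 / 2)"
  have on: "(\<integral>\<^sup>+u. G (masked_half_square q u (1 / q)) \<partial>gauss_entry 1) =
      ennreal (1 / 2) * G 0 + ennreal (1 / 2) * ?g"
    using q nn_integral_gaussian_relu[OF G] by (simp add: masked_half_square_def)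
  have off: "(\<integral>\<^sup>+u. G (masked_half_square q u 0) \<partial>gauss_entry 1) = G 0"
    using N.emeasure_space_1 by (simp add: masked_half_square_def)
  have "(\<integral>\<^sup>+e. \<integral>\<^sup>+u. G (masked_half_square q u e) \<partial>gauss_entry 1 \<partial>dropout_entry q) =
      (ennreal (1 / 2) * G 0 + ennreal (1 / 2) * ?g) * ennreal q + G 0 * ennreal (1 - q)"
    unfolding dropout_entry_def using q
    by (simp add: on off del: ennreal_half)
  also have "\<dots> = ?g * (ennreal (1 / 2) * ennreal q) +
      G 0 * (ennreal (1 / 2) * ennreal q + ennreal (1 - q))"
    by (simp only: distrib_left distrib_right mult_ac add_ac)
  also have "ennreal (1 / 2) * ennreal q = ennreal (q / 2)"
    using q by (simp add: ennreal_mult' [symmetric] del: ennreal_half)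
  also have "ennreal (q / 2) + ennreal (1 - q) = ennreal (1 - q / 2)"
    using q by (simp add: ennreal_plus [symmetric] del: ennreal_plus)
  finally show ?thesis
    using q by (simp add: nn_integral_gamma_law_0)
qed

text \<open>Induction over the coordinates: each new one adds a Bernoulli(q/2) variable to the count
  of active coordinates and half that variable to the Gamma shape. The test function stays arbitrary
  because the induction hypothesis is applied to translates of \<open>F\<close>.\<close>

lemma nn_integral_sum_masked_half_square:
  assumes q: "0 < q" "q \<le> 1" and "finite I" and "F \<in> borel_measurable borel"
  shows "(\<integral>\<^sup>+\<epsilon>. \<integral>\<^sup>+U. F (\<Sum>i\<in>I. masked_half_square q (U i) (\<epsilon> i))
        \<partial>PiM I (\<lambda>_. gauss_entry 1) \<partial>PiM I (\<lambda>_. dropout_entry q)) =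
    (\<integral>\<^sup>+n. \<integral>\<^sup>+x. F x \<partial>gamma_law (real n / 2) \<partial>measure_pmf (binomial_pmf (card I) (q / 2)))"
  using assms(3,4)
proof (induction I arbitrary: F rule: finite_induct)
  case empty
  then show ?case
    using q by (simp add: PiM_empty nn_integral_count_space_finite binomial_pmf_0 nn_integral_gamma_law_0)
next
  case (insert i I)
  note [measurable] = \<open>F \<in> borel_measurable borel\<close>
  let ?N = "\<lambda>_::'a. gauss_entry 1" and ?D = "\<lambda>_::'a. dropout_entry q"
  let ?h = "masked_half_square q"
  let ?bin = "measure_pmf (binomial_pmf (card I) (q / 2))"
  let ?ber = "measure_pmf (bernoulli_pmf (q / 2))"
  have fin: "finite (set_pmf (binomial_pmf (card I) (q / 2)))"
    using q by (intro finite_set_pmf_binomial_pmf) auto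
  interpret N1: prob_space "gauss_entry 1" by (rule prob_space_gauss_entry) simp
  interpret D1: prob_space "dropout_entry q" by (rule prob_space_dropout_entry)
  interpret N: product_prob_space ?N by standard
  interpret D: product_prob_space ?D by standard
  interpret NI: prob_space "PiM J ?N" for J by (intro prob_space_PiM N1.prob_space_axioms)
  interpret DI: prob_space "PiM J ?D" for J by (intro prob_space_PiM D1.prob_space_axioms)
  have joint: "(\<lambda>p. F (\<Sum>k\<in>insert i I. ?h (snd p k) (fst p k)))
      \<in> borel_measurable (PiM (insert i I) ?D \<Otimes>\<^sub>M PiM (insert i I) ?N)"
    by (rule measurable_compose[OF _ insert.prems])
      (intro borel_measurable_sum measurable_masked_half_square measurable_gauss_snd measurable_dropout_fst)
  have split: "(\<Sum>k\<in>insert i I. ?h ((U(i := u)) k) ((\<epsilon>(i := e)) k)) =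
      ?h u e + (\<Sum>k\<in>I. ?h (U k) (\<epsilon> k))" for U u \<epsilon> e
  proof -
    have "(\<Sum>k\<in>I. ?h ((U(i := u)) k) ((\<epsilon>(i := e)) k)) = (\<Sum>k\<in>I. ?h (U k) (\<epsilon> k))"
      using insert.hyps by (intro sum.cong) auto
    then show ?thesis using insert.hyps by simp
  qed
  \<comment> \<open>\<open>G c\<close> is the value predicted for the old coordinates when the new
    one contributes \<open>c\<close>.\<close>
  define G where "G c = (\<integral>\<^sup>+n. \<integral>\<^sup>+x. F (c + x) \<partial>gamma_law (real n / 2) \<partial>?bin)" for c
  interpret g: prob_space "gamma_law (real n / 2)" for n by (rule prob_space_gamma_law) simp
  have mg: "(\<lambda>c. \<integral>\<^sup>+x. F (c + x) \<partial>gamma_law (real n / 2)) \<in> borel_measurable borel" for n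
    by measurable
  have G [measurable]: "G \<in> borel_measurable borel"
    unfolding G_def nn_integral_measure_pmf_finite[OF fin] using mg by measurable
  have "(\<integral>\<^sup>+\<epsilon>. \<integral>\<^sup>+U. F (\<Sum>k\<in>insert i I. ?h (U k) (\<epsilon> k)) \<partial>PiM (insert i I) ?N \<partial>PiM (insert i I) ?D) =
      (\<integral>\<^sup>+e. \<integral>\<^sup>+\<epsilon>. \<integral>\<^sup>+U. F (\<Sum>k\<in>insert i I. ?h (U k) ((\<epsilon>(i := e)) k))
        \<partial>PiM (insert i I) ?N \<partial>PiM I ?D \<partial>dropout_entry q)"
  proof (rule D.product_nn_integral_insert_rev[OF insert.hyps])
    show "(\<lambda>\<epsilon>. \<integral>\<^sup>+U. F (\<Sum>k\<in>insert i I. ?h (U k) (\<epsilon> k)) \<partial>PiM (insert i I) ?N)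
        \<in> borel_measurable (PiM (insert i I) ?D)"
      using NI.borel_measurable_nn_integral_fst[OF joint] by simp
  qed
  also have "\<dots> = (\<integral>\<^sup>+e. \<integral>\<^sup>+\<epsilon>. \<integral>\<^sup>+u. \<integral>\<^sup>+U. F (?h u e + (\<Sum>k\<in>I. ?h (U k) (\<epsilon> k)))
        \<partial>PiM I ?N \<partial>gauss_entry 1 \<partial>PiM I ?D \<partial>dropout_entry q)"
  proof (rule nn_integral_cong, rule nn_integral_cong)
    fix e \<epsilon>
    have "(\<lambda>U. F (\<Sum>k\<in>insert i I. ?h (U k) ((\<epsilon>(i := e)) k))) \<in> borel_measurable (PiM (insert i I) ?N)"
      by measurable
    from N.product_nn_integral_insert_rev[OF insert.hyps this]
    show "(\<integral>\<^sup>+U. F (\<Sum>k\<in>insert i I. ?h (U k) ((\<epsilon>(i := e)) k)) \<partial>PiM (insert i I) ?N) =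
        (\<integral>\<^sup>+u. \<integral>\<^sup>+U. F (?h u e + (\<Sum>k\<in>I. ?h (U k) (\<epsilon> k))) \<partial>PiM I ?N \<partial>gauss_entry 1)"
      unfolding split .
  qed
  \<comment> \<open>Moving the new Gaussian outside the old dropout vector brings the two integrals
    over the old coordinates together, as the induction hypothesis requires.\<close>
  also have "\<dots> = (\<integral>\<^sup>+e. \<integral>\<^sup>+u. \<integral>\<^sup>+\<epsilon>. \<integral>\<^sup>+U. F (?h u e + (\<Sum>k\<in>I. ?h (U k) (\<epsilon> k)))
        \<partial>PiM I ?N \<partial>PiM I ?D \<partial>gauss_entry 1 \<partial>dropout_entry q)"
  proof (rule nn_integral_cong)
    fix e
    interpret P: pair_sigma_finite "PiM I ?D" "gauss_entry 1" by standard
    have m\<epsilon>: "(\<lambda>p. fst (fst p) k) \<in> borel_measurable ((PiM I ?D \<Otimes>\<^sub>M gauss_entry 1) \<Otimes>\<^sub>M PiM I ?N)"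
      if "k \<in> I" for k
      by (rule measurable_compose[OF measurable_fst measurable_dropout_fst[OF that]])
    have "(\<lambda>p. F (?h (snd (fst p)) e + (\<Sum>k\<in>I. ?h (snd p k) (fst (fst p) k))))
        \<in> borel_measurable ((PiM I ?D \<Otimes>\<^sub>M gauss_entry 1) \<Otimes>\<^sub>M PiM I ?N)"
      by (rule measurable_compose[OF _ insert.prems],
          intro borel_measurable_add borel_measurable_sum measurable_masked_half_square measurable_gauss_snd m\<epsilon>) measurable
    from NI.borel_measurable_nn_integral_fst[OF this]
    show "(\<integral>\<^sup>+\<epsilon>. \<integral>\<^sup>+u. \<integral>\<^sup>+U. F (?h u e + (\<Sum>k\<in>I. ?h (U k) (\<epsilon> k))) \<partial>PiM I ?N \<partial>gauss_entry 1 \<partial>PiM I ?D) =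
        (\<integral>\<^sup>+u. \<integral>\<^sup>+\<epsilon>. \<integral>\<^sup>+U. F (?h u e + (\<Sum>k\<in>I. ?h (U k) (\<epsilon> k))) \<partial>PiM I ?N \<partial>PiM I ?D \<partial>gauss_entry 1)"
      by (intro P.Fubini'[symmetric]) (simp add: case_prod_unfold)
  qed
  also have "\<dots> = (\<integral>\<^sup>+e. \<integral>\<^sup>+u. G (?h u e) \<partial>gauss_entry 1 \<partial>dropout_entry q)"
    unfolding G_def by (intro nn_integral_cong insert.IH) measurable
  also have "\<dots> = (\<integral>\<^sup>+b. \<integral>\<^sup>+c. G c \<partial>gamma_law ((if b then 1 else 0) / 2) \<partial>?ber)"
    by (rule nn_integral_masked_half_square[OF q G])
  also have "\<dots> = (\<integral>\<^sup>+b. \<integral>\<^sup>+n. \<integral>\<^sup>+c. \<integral>\<^sup>+x. F (c + x) \<partial>gamma_law (real n / 2)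
      \<partial>gamma_law ((if b then 1 else 0) / 2) \<partial>?bin \<partial>?ber)"
    unfolding G_def using mg by (intro nn_integral_cong nn_integral_pmf_swap[OF fin]) simp
  \<comment> \<open>Additivity of Gamma laws; it includes shape 0 on either side, that is, an
    inactive new coordinate or \<open>n = 0\<close>.\<close>
  also have "\<dots> = (\<integral>\<^sup>+b. \<integral>\<^sup>+n. \<integral>\<^sup>+z. F z \<partial>gamma_law ((if b then 1 else 0) / 2 + real n / 2) \<partial>?bin \<partial>?ber)"
    by (intro nn_integral_cong nn_integral_gamma_law_add) auto
  \<comment> \<open>A binomial count is an independent Bernoulli variable plus a binomial count with
    one trial fewer.\<close>
  also have "\<dots> = (\<integral>\<^sup>+n. \<integral>\<^sup>+x. F x \<partial>gamma_law (real n / 2) \<partial>measure_pmf (binomial_pmf (card (insert i I)) (q / 2)))"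
    using q insert.hyps by (simp add: binomial_pmf_Suc add_divide_distrib)
  finally show ?case .
qed

subsection \<open>Moments of a single layer\<close>

text \<open>The joint law of all coordinates is the product measure itself and the marginals are its
  factors, which is the product criterion for independence.\<close>

lemma indep_vars_PiM_projection:
  assumes M: "\<And>i. i \<in> I \<Longrightarrow> prob_space (M i)" and "I \<noteq> {}"
  shows "prob_space.indep_vars (PiM I M) M (\<lambda>i \<omega>. \<omega> i) I"
proof -
  interpret prob_space "PiM I M" by (rule prob_space_PiM) fact
  have "distr (PiM I M) (PiM I M) (\<lambda>\<omega>. \<lambda>i\<in>I. \<omega> i) = distr (PiM I M) (PiM I M) (\<lambda>\<omega>. \<omega>)"
    by (rule distr_cong) (auto simp: space_PiM)
  also have "\<dots> = PiM I M" by (rule distr_id)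
  also have "\<dots> = PiM I (\<lambda>i. distr (PiM I M) (M i) (\<lambda>\<omega>. \<omega> i))"
    using M by (intro PiM_cong refl) (simp add: distr_PiM_component)
  finally show ?thesis
    using \<open>I \<noteq> {}\<close> by (subst indep_vars_iff_distr_eq_PiM') auto
qed

lemma distributed_gauss_linear_form:
  fixes y :: "real^'d::finite" and i :: 'd
  assumes \<sigma>: "0 < \<sigma>" and y: "y \<noteq> 0"
  shows "distributed (PiM (UNIV :: ('d \<times> 'd) set) (\<lambda>_. gauss_entry \<sigma>)) lborel
    (\<lambda>W. \<Sum>j\<in>UNIV. W (i, j) * y $ j) (normal_density 0 (\<sigma> * norm y))"
proof -
  let ?M = "PiM (UNIV :: ('d \<times> 'd) set) (\<lambda>_. gauss_entry \<sigma>)"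
  have pg: "prob_space (gauss_entry \<sigma>)" using \<sigma> by (rule prob_space_gauss_entry)
  interpret prob_space ?M by (intro prob_space_PiM pg)
  \<comment> \<open>Entries meeting a zero coordinate of \<open>y\<close> give summands of variance
    0, which have no normal density; they are left out of the sum of independent normals.\<close>
  define J where "J = {j. y $ j \<noteq> 0}"
  have J: "finite J" "J \<noteq> {}" using y by (auto simp: J_def vec_eq_iff)
  have proj: "indep_vars (\<lambda>_. gauss_entry \<sigma>) (\<lambda>p W. W p) UNIV"
    by (rule indep_vars_PiM_projection) (auto intro: pg)
  \<comment> \<open>Singleton blocks of row \<open>i\<close> transfer independence from the index
    pairs to the column index \<open>j\<close>.\<close>
  have "indep_vars (\<lambda>j. PiM {(i, j)} (\<lambda>_. gauss_entry \<sigma>)) (\<lambda>j W. restrict (\<lambda>p. W p) {(i, j)}) J"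
    by (rule indep_vars_restrict[OF proj]) (auto simp: disjoint_family_on_def)
  then have "indep_vars (\<lambda>_. borel) (\<lambda>j W. (restrict (\<lambda>p. W p) {(i, j)}) (i, j) * y $ j) J"
    by (rule indep_vars_compose2[where Y = "\<lambda>j f. f (i, j) * y $ j"]) measurable
  then have indep: "indep_vars (\<lambda>_. borel) (\<lambda>j W. W (i, j) * y $ j) J"
    by simp
  have "distributed ?M lborel (\<lambda>W. W (i, j)) (normal_density 0 \<sigma>)" for j
  proof -
    have "distr ?M lborel (\<lambda>W. W (i, j)) = distr ?M (gauss_entry \<sigma>) (\<lambda>W. W (i, j))"
      by (rule distr_cong) auto
    also have "\<dots> = gauss_entry \<sigma>"
      by (rule distr_PiM_component) (auto intro: pg)
    finally show ?thesis
      by (simp add: distributed_def gauss_entry_def)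
  qed
  from normal_density_affine[OF this \<sigma>, where \<beta> = 0]
  have "distributed ?M lborel (\<lambda>W. W (i, j) * y $ j) (normal_density 0 (\<bar>y $ j\<bar> * \<sigma>))" if "j \<in> J" for j
    using that by (simp add: J_def mult.commute)
  then have "distributed ?M lborel (\<lambda>W. \<Sum>j\<in>J. W (i, j) * y $ j)
      (normal_density (\<Sum>j\<in>J. 0) (sqrt (\<Sum>j\<in>J. (\<bar>y $ j\<bar> * \<sigma>)\<^sup>2)))"
    using \<sigma> by (intro sum_indep_normal[OF J indep]) (auto simp: J_def)
  moreover have "(\<Sum>j\<in>J. W (i, j) * y $ j) = (\<Sum>j\<in>UNIV. W (i, j) * y $ j)" for W
    by (rule sum.mono_neutral_left) (auto simp: J_def)
  moreover have "sqrt (\<Sum>j\<in>J. (\<bar>y $ j\<bar> * \<sigma>)\<^sup>2) = \<sigma> * norm y"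
  proof -
    have "(\<Sum>j\<in>J. (\<bar>y $ j\<bar> * \<sigma>)\<^sup>2) = (\<Sum>j\<in>UNIV. (\<bar>y $ j\<bar> * \<sigma>)\<^sup>2)"
      by (rule sum.mono_neutral_left) (auto simp: J_def)
    also have "\<dots> = \<sigma>\<^sup>2 * (\<Sum>j\<in>UNIV. (y $ j)\<^sup>2)"
      by (simp add: power_mult_distrib sum_distrib_left mult.commute)
    finally show ?thesis
      using \<sigma> by (simp add: real_sqrt_mult norm_vec_def L2_set_def)
  qed
  ultimately show ?thesis by simp
qed

text \<open>Distinct pre-activations use disjoint rows and are hence independent; each is Gaussian
  with standard deviation \<open>\<sigma> * norm y\<close>. So their joint law is the product law on
  the right.\<close>

lemma nn_integral_gauss_matrix:
  fixes y :: "real^'d::finite"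
  assumes \<sigma>: "0 < \<sigma>" and y: "y \<noteq> 0"
    and H [measurable]: "H \<in> borel_measurable (PiM UNIV (\<lambda>_. borel))"
  shows "(\<integral>\<^sup>+W. H (\<lambda>i. \<Sum>j\<in>UNIV. W (i, j) * y $ j) \<partial>PiM (UNIV :: ('d \<times> 'd) set) (\<lambda>_. gauss_entry \<sigma>)) =
    (\<integral>\<^sup>+U. H U \<partial>PiM UNIV (\<lambda>_. gauss_entry (\<sigma> * norm y)))"
proof -
  let ?M = "PiM (UNIV :: ('d \<times> 'd) set) (\<lambda>_. gauss_entry \<sigma>)"
  let ?X = "\<lambda>i W. \<Sum>j\<in>UNIV. W (i, j) * y $ j"
  have pg: "prob_space (gauss_entry \<sigma>)" using \<sigma> by (rule prob_space_gauss_entry)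
  interpret prob_space ?M by (intro prob_space_PiM pg)
  have proj: "indep_vars (\<lambda>_. gauss_entry \<sigma>) (\<lambda>p W. W p) UNIV"
    by (rule indep_vars_PiM_projection) (auto intro: pg)
  have "indep_vars (\<lambda>i. PiM ({i} \<times> UNIV) (\<lambda>_. gauss_entry \<sigma>))
      (\<lambda>i W. restrict (\<lambda>p. W p) ({i} \<times> (UNIV :: 'd set))) (UNIV :: 'd set)"
    by (rule indep_vars_restrict[OF proj]) (auto simp: disjoint_family_on_def)
  then have "indep_vars (\<lambda>_. borel) (\<lambda>i W. ?X i (restrict (\<lambda>p. W p) ({i} \<times> UNIV))) (UNIV :: 'd set)"
    by (rule indep_vars_compose2[where Y = ?X]) measurable
  then have indep: "indep_vars (\<lambda>_. borel) ?X UNIV"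
    by simp
  have rv: "?X i \<in> borel_measurable ?M" for i by measurable
  have "distr ?M (PiM UNIV (\<lambda>_. borel)) (\<lambda>W. \<lambda>i\<in>UNIV. ?X i W) = PiM UNIV (\<lambda>i. distr ?M borel (?X i))"
    using indep rv by (subst (asm) indep_vars_iff_distr_eq_PiM) auto
  also have "\<dots> = PiM UNIV (\<lambda>_. gauss_entry (\<sigma> * norm y))"
  proof (intro PiM_cong refl)
    fix i
    have "distr ?M borel (?X i) = distr ?M lborel (?X i)" by (rule distr_cong) auto
    also have "\<dots> = gauss_entry (\<sigma> * norm y)"
      using distributed_gauss_linear_form[OF \<sigma> y, of i]
      by (simp add: distributed_def gauss_entry_def)
    finally show "distr ?M borel (?X i) = gauss_entry (\<sigma> * norm y)" .
  qed
  finally have "(\<integral>\<^sup>+U. H U \<partial>PiM UNIV (\<lambda>_. gauss_entry (\<sigma> * norm y))) =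
      (\<integral>\<^sup>+U. H U \<partial>distr ?M (PiM UNIV (\<lambda>_. borel)) (\<lambda>W. \<lambda>i\<in>UNIV. ?X i W))"
    by simp
  also have "\<dots> = (\<integral>\<^sup>+W. H (\<lambda>i. ?X i W) \<partial>?M)"
  proof -
    have "(\<lambda>W. \<lambda>i\<in>UNIV. ?X i W) \<in> ?M \<rightarrow>\<^sub>M PiM UNIV (\<lambda>_. borel)"
      by (intro measurable_restrict rv)
    from nn_integral_distr[OF this, of H] show ?thesis by (simp add: restrict_UNIV)
  qed
  finally show ?thesis ..
qed

text \<open>The recursion step of \<open>net_state\<close> as a function of its input, so that a
  layer can be applied to the initial vector as well as to the last state.\<close>

definition relu_layer :: "real^'d::finite \<Rightarrow> ('d \<times> 'd \<Rightarrow> real) \<times> ('d \<Rightarrow> real) \<Rightarrow> real^'d" where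
  "relu_layer x w = (\<chi> i. relu (\<Sum>j\<in>UNIV. fst w (i, j) * x $ j) * snd w i)"

lemma relu_mult_nonneg: "0 \<le> c \<Longrightarrow> relu (c * z) = c * relu z"
  by (simp add: relu_def max_mult_distrib_left)

lemma relu_layer_scaleR:
  assumes "0 \<le> c"
  shows "relu_layer (c *\<^sub>R x) w = c *\<^sub>R relu_layer x w"
proof -
  have "(\<Sum>j\<in>UNIV. fst w (i, j) * (c * x $ j)) = c * (\<Sum>j\<in>UNIV. fst w (i, j) * x $ j)" for i
    by (simp add: sum_distrib_left mult_ac)
  then show ?thesis
    using assms by (simp add: relu_layer_def vec_eq_iff relu_mult_nonneg)
qed

text \<open>The factor \<open>2 / q\<^sup>2\<close> undoes the halving and the rescaling of the
  dropout values built into \<open>masked_half_square\<close>.\<close>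

lemma norm_relu_layer:
  assumes "0 < q"
  shows "norm (relu_layer x w) =
    sqrt (2 / q\<^sup>2 * (\<Sum>i\<in>UNIV. masked_half_square q (\<Sum>j\<in>UNIV. fst w (i, j) * x $ j) (snd w i)))"
  using assms
  by (simp add: norm_vec_def L2_set_def relu_layer_def masked_half_square_def sum_distrib_left power_mult_distrib)

lemma prob_space_layer_space: "0 < \<sigma> \<Longrightarrow> prob_space (layer_space \<sigma> q)"
  unfolding layer_space_def
  by (intro prob_space_pair prob_space_PiM prob_space_gauss_entry prob_space_dropout_entry)

lemma measurable_layer_weight [measurable]:
  "(\<lambda>w. fst w p) \<in> borel_measurable (layer_space \<sigma> q)"
  unfolding layer_space_def by measurable

lemma measurable_layer_dropout [measurable]:
  "(\<lambda>w. snd w i) \<in> borel_measurable (layer_space \<sigma> q)"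
  unfolding layer_space_def
  by (rule measurable_compose[OF measurable_snd measurable_dropout_component]) simp

lemma measurable_norm_relu_layer [measurable]:
  "(\<lambda>w. norm (relu_layer x w)) \<in> borel_measurable (layer_space \<sigma> q)"
  unfolding norm_vec_def L2_set_def relu_layer_def by simp

lemma nn_integral_relu_layer_normalised:
  fixes y :: "real^'d::finite"
  assumes q: "0 < q" "q \<le> 1" and \<sigma>: "0 < \<sigma>" and y: "\<sigma> * norm y = 1"
    and F [measurable]: "F \<in> borel_measurable borel"
  shows "(\<integral>\<^sup>+w. F (norm (relu_layer y w)) \<partial>layer_space \<sigma> q) =
    (\<integral>\<^sup>+n. \<integral>\<^sup>+x. F (sqrt (2 / q\<^sup>2 * x)) \<partial>gamma_law (real n / 2) \<partial>measure_pmf (binomial_pmf CARD('d) (q / 2)))"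
proof -
  let ?W = "PiM (UNIV :: ('d \<times> 'd) set) (\<lambda>_. gauss_entry \<sigma>)"
  let ?D = "PiM (UNIV :: 'd set) (\<lambda>_. dropout_entry q)"
  let ?F = "\<lambda>x. F (sqrt (2 / q\<^sup>2 * x))"
  interpret W: prob_space ?W using \<sigma> by (intro prob_space_PiM prob_space_gauss_entry)
  interpret D: prob_space ?D by (intro prob_space_PiM prob_space_dropout_entry)
  interpret P: pair_sigma_finite ?W ?D by standard
  have y0: "y \<noteq> 0" using y by auto
  \<comment> \<open>The weights are integrated first, with the dropout vector frozen, so that the
    matrix can be replaced by independent standard Gaussians.\<close>
  have "(\<integral>\<^sup>+w. F (norm (relu_layer y w)) \<partial>layer_space \<sigma> q) =
      (\<integral>\<^sup>+\<epsilon>. \<integral>\<^sup>+W. F (norm (relu_layer y (W, \<epsilon>))) \<partial>?W \<partial>?D)"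
    unfolding layer_space_def
    by (rule P.nn_integral_snd[symmetric]) (unfold layer_space_def[symmetric], measurable)
  also have "\<dots> = (\<integral>\<^sup>+\<epsilon>. \<integral>\<^sup>+U. ?F (\<Sum>i\<in>UNIV. masked_half_square q (U i) (\<epsilon> i))
      \<partial>PiM UNIV (\<lambda>_. gauss_entry 1) \<partial>?D)"
  proof (rule nn_integral_cong)
    fix \<epsilon> :: "'d \<Rightarrow> real"
    have "(\<lambda>U. ?F (\<Sum>i\<in>UNIV. masked_half_square q (U i) (\<epsilon> i))) \<in> borel_measurable (PiM UNIV (\<lambda>_. borel))"
      by measurable
    from nn_integral_gauss_matrix[OF \<sigma> y0 this]
    show "(\<integral>\<^sup>+W. F (norm (relu_layer y (W, \<epsilon>))) \<partial>?W) =
        (\<integral>\<^sup>+U. ?F (\<Sum>i\<in>UNIV. masked_half_square q (U i) (\<epsilon> i)) \<partial>PiM UNIV (\<lambda>_. gauss_entry 1))"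
      using q by (simp add: norm_relu_layer y)
  qed
  also have "\<dots> = (\<integral>\<^sup>+n. \<integral>\<^sup>+x. ?F x \<partial>gamma_law (real n / 2) \<partial>measure_pmf (binomial_pmf CARD('d) (q / 2)))"
    by (rule nn_integral_sum_masked_half_square[OF q]) auto
  finally show ?thesis .
qed

section \<open>Fractional moments of the binomial Gamma mixture\<close>

lemma qd_nonneg: "0 < q \<Longrightarrow> q \<le> 1 \<Longrightarrow> 0 \<le> qd d q n"
  by (simp add: qd_def)

lemma I0q_pos:
  assumes "0 < q" "q \<le> 1" "0 < s" "0 < d"
  shows "0 < I0q q s d"
proof -
  have "0 < qd d q n * Gamma (real n / 2 + s / 2) / Gamma (real n / 2)" if "n \<in> {1..d}" for n
    using that assms by (auto simp: qd_def intro!: mult_pos_pos divide_pos_pos Gamma_real_pos add_pos_pos)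
  then have "0 < (\<Sum>n = 1..d. qd d q n * Gamma (real n / 2 + s / 2) / Gamma (real n / 2))"
    using assms by (intro sum_pos) auto
  then show ?thesis using assms by (simp add: I0q_def)
qed

text \<open>This identifies \<open>I0q\<close> as the moment of order \<open>s\<close> of the output
  norm when the pre-activations are standard: a binomial average of the Gamma moments of order
  \<open>s / 2\<close>.\<close>

lemma nn_integral_binomial_gamma_powr:
  assumes q: "0 < q" "q \<le> 1" and s: "0 < s"
  shows "(\<integral>\<^sup>+n. \<integral>\<^sup>+x. ennreal (sqrt (2 / q\<^sup>2 * x) powr s) \<partial>gamma_law (real n / 2)
      \<partial>measure_pmf (binomial_pmf d (q / 2))) = ennreal (I0q q s d)"
proof -
  let ?c = "2 powr (s / 2) / q powr s"
  \<comment> \<open>The value 0 at \<open>n = 0\<close> is the moment of the point mass at zero; it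
    is the reason why the sum in \<open>I0q\<close> starts at 1.\<close>
  let ?g = "\<lambda>n. if n = 0 then 0 else Gamma (real n / 2 + s / 2) / Gamma (real n / 2)"
  have g_nonneg: "0 \<le> ?g n" for n :: nat
    using s by (auto intro!: divide_nonneg_nonneg less_imp_le[OF Gamma_real_pos] add_pos_pos)
  have inner: "(\<integral>\<^sup>+x. ennreal (sqrt (2 / q\<^sup>2 * x) powr s) \<partial>gamma_law (real n / 2)) = ennreal (?c * ?g n)" for n
  proof (cases "n = 0")
    case True
    then show ?thesis by (simp add: nn_integral_gamma_law_0)
  next
    case False
    have "sqrt (2 / q\<^sup>2 * x) powr s = ?c * x powr (s / 2)" if "0 \<le> x" for x
    proof -
      have "sqrt (2 / q\<^sup>2 * x) powr s = (2 / q\<^sup>2 * x) powr (s / 2)"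
        using that by (simp add: powr_half_sqrt [symmetric] powr_powr)
      also have "\<dots> = 2 powr (s / 2) / (q\<^sup>2) powr (s / 2) * x powr (s / 2)"
        using that q by (simp add: powr_mult powr_divide)
      also have "(q\<^sup>2) powr (s / 2) = q powr s"
        using q by (simp add: powr_powr flip: powr_numeral)
      finally show ?thesis .
    qed
    then have "ennreal (gamma_density (real n / 2) x) * ennreal (sqrt (2 / q\<^sup>2 * x) powr s) =
        ennreal (gamma_density (real n / 2) x) * ennreal (?c * x powr (s / 2))" for x
      by (cases "0 \<le> x") (auto simp: gamma_density_def)
    then have "(\<integral>\<^sup>+x. ennreal (sqrt (2 / q\<^sup>2 * x) powr s) \<partial>gamma_law (real n / 2)) =
        (\<integral>\<^sup>+x. ennreal (?c * x powr (s / 2)) \<partial>gamma_law (real n / 2))"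
      using False by (simp add: nn_integral_gamma_law)
    also have "\<dots> = (\<integral>\<^sup>+x. ennreal ?c * ennreal (x powr (s / 2)) \<partial>gamma_law (real n / 2))"
      by (subst ennreal_mult') auto
    also have "\<dots> = ennreal ?c * ennreal (?g n)"
      using False s by (subst nn_integral_cmult) (auto simp: nn_integral_gamma_law_powr)
    finally show ?thesis
      by (simp add: ennreal_mult' [symmetric])
  qed
  have set: "set_pmf (binomial_pmf d (q / 2)) = {..d}"
    using q by (intro set_pmf_binomial) auto
  have "(\<integral>\<^sup>+n. ennreal (?c * ?g n) \<partial>measure_pmf (binomial_pmf d (q / 2))) =
      (\<Sum>n\<le>d. ennreal (?c * ?g n) * ennreal (qd d q n))"
    using q by (subst nn_integral_measure_pmf_finite) (auto simp: set qd_def intro!: sum.cong)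
  also have "\<dots> = (\<Sum>n\<le>d. ennreal (?c * ?g n * qd d q n))"
    using q qd_nonneg[of q d] g_nonneg by (intro sum.cong refl ennreal_mult'' [symmetric]) auto
  also have "\<dots> = ennreal (\<Sum>n\<le>d. ?c * ?g n * qd d q n)"
    using q qd_nonneg[of q d] g_nonneg by (intro sum_ennreal mult_nonneg_nonneg) auto
  also have "(\<Sum>n\<le>d. ?c * ?g n * qd d q n) = (\<Sum>n = 1..d. ?c * ?g n * qd d q n)"
    by (rule sum.mono_neutral_right) auto
  also have "\<dots> = I0q q s d"
    unfolding I0q_def sum_distrib_left by (intro sum.cong) auto
  finally show ?thesis unfolding inner .
qed

lemma nn_integral_norm_relu_layer_powr:
  fixes x :: "real^'d::finite"
  assumes q: "0 < q" "q \<le> 1" and s: "0 < s" and \<sigma>: "0 < \<sigma>"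
  shows "(\<integral>\<^sup>+w. ennreal (norm (relu_layer x w) powr s) \<partial>layer_space \<sigma> q) =
    ennreal (norm x powr s * (\<sigma> powr s * I0q q s CARD('d)))"
proof (cases "x = 0")
  case True
  then have "relu_layer x w = 0" for w
    by (simp add: relu_layer_def relu_def vec_eq_iff)
  then show ?thesis using True by simp
next
  case False
  let ?c = "\<sigma> * norm x"
  have c: "0 < ?c" using False \<sigma> by simp
  \<comment> \<open>Rescaling makes the pre-activations standard Gaussian; positive homogeneity of
    the layer returns the factor \<open>?c powr s\<close>.\<close>
  define y where "y = (1 / ?c) *\<^sub>R x"
  have x: "x = ?c *\<^sub>R y" and y: "\<sigma> * norm y = 1"
    using c False \<sigma> by (auto simp: y_def)
  have "norm (relu_layer x w) powr s = ?c powr s * norm (relu_layer y w) powr s" for w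
    using c by (subst x) (simp add: relu_layer_scaleR powr_mult)
  then have "(\<integral>\<^sup>+w. ennreal (norm (relu_layer x w) powr s) \<partial>layer_space \<sigma> q) =
      (\<integral>\<^sup>+w. ennreal (?c powr s) * ennreal (norm (relu_layer y w) powr s) \<partial>layer_space \<sigma> q)"
    by (simp add: ennreal_mult')
  also have "\<dots> = ennreal (?c powr s) * (\<integral>\<^sup>+w. ennreal (norm (relu_layer y w) powr s) \<partial>layer_space \<sigma> q)"
    by (rule nn_integral_cmult) measurable
  also have "(\<integral>\<^sup>+w. ennreal (norm (relu_layer y w) powr s) \<partial>layer_space \<sigma> q) = ennreal (I0q q s CARD('d))"
    unfolding nn_integral_binomial_gamma_powr[OF q s, symmetric]
    by (rule nn_integral_relu_layer_normalised[OF q \<sigma> y]) measurable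
  finally show ?thesis
    using \<sigma> by (subst (asm) ennreal_mult' [symmetric]) (auto simp: powr_mult mult_ac)
qed

subsection \<open>The moments of the network\<close>

lemma powr_tangent_le:
  fixes r m t :: real
  assumes "1 < r" "0 < m" "0 \<le> t"
  shows "r * m powr (r - 1) * t \<le> t powr r + (r - 1) * m powr r"
proof -
  \<comment> \<open>The claim says that the convex function \<open>t powr r\<close> lies above its
    tangent at \<open>m\<close>. It is Young's inequality for the conjugate exponents
    \<open>r\<close> and \<open>r / (r - 1)\<close>, multiplied by \<open>r\<close>.\<close>
  have "t * m powr (r - 1) \<le> t powr r / r + (m powr (r - 1)) powr (r / (r - 1)) / (r / (r - 1))"
    using assms by (intro Youngs_inequality) (auto simp: field_simps)
  also have "(m powr (r - 1)) powr (r / (r - 1)) = m powr r"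
    using assms by (simp add: powr_powr)
  finally show ?thesis
    using assms by (simp add: field_simps)
qed

text \<open>Strict Lyapunov inequality for the layer norm; strictness comes from the atom of
  mass \<open>(1 - q / 2) ^ d\<close> at zero.\<close>
lemma I0q_powr_less:
  assumes q: "0 < q" "q \<le> 1" and s: "0 < s" and p: "s < p" and d: "0 < d"
  shows "I0q q s d powr (p / s) < I0q q p d"
proof -
  let ?bin = "measure_pmf (binomial_pmf d (q / 2))"
  let ?z = "\<lambda>x. sqrt (2 / q\<^sup>2 * x)"
  define r where "r = p / s"
  define m where "m = I0q q s d"
  define a where "a = (1 - q / 2) ^ d"
  have r: "1 < r" using s p by (simp add: r_def)
  have m: "0 < m" unfolding m_def by (rule I0q_pos[OF q s d])
  have Ip: "0 < I0q q p d" using s p by (intro I0q_pos[OF q _ d]) simp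
  have a: "0 < a" "a \<le> 1" using q by (auto simp: a_def intro!: power_le_one)
  \<comment> \<open>The tangent is taken at the mean \<open>m\<close> of \<open>z powr s\<close>, as
    in the proof of Jensen's inequality.\<close>
  have pointwise: "r * m powr (r - 1) * z powr s \<le> z powr p + (r - 1) * m powr r" if "0 \<le> z" for z
    using powr_tangent_le[OF r m, of "z powr s"] s by (simp add: powr_powr r_def)
  have inner: "(\<integral>\<^sup>+x. ennreal (r * m powr (r - 1)) * ennreal (?z x powr s) \<partial>gamma_law (real n / 2)) \<le>
      (\<integral>\<^sup>+x. ennreal (?z x powr p) \<partial>gamma_law (real n / 2)) + ennreal ((r - 1) * m powr r) * indicator {1..} n" for n
  proof (cases "n = 0")
    case True
    then show ?thesis by (simp add: nn_integral_gamma_law_0)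
  next
    case False
    interpret g: prob_space "gamma_law (real n / 2)" by (rule prob_space_gamma_law) simp
    have le: "ennreal (r * m powr (r - 1)) * ennreal (?z x powr s) \<le>
        ennreal (?z x powr p) + ennreal ((r - 1) * m powr r)" if "0 \<le> x" for x
      using pointwise[of "?z x"] r that
      by (simp add: ennreal_mult' [symmetric] ennreal_plus [symmetric] ennreal_leI del: ennreal_plus)
    have "ennreal (gamma_density (real n / 2) x) * (ennreal (r * m powr (r - 1)) * ennreal (?z x powr s)) \<le>
        ennreal (gamma_density (real n / 2) x) * (ennreal (?z x powr p) + ennreal ((r - 1) * m powr r))" for x
    proof (cases "0 \<le> x")
      case True
      then show ?thesis by (intro mult_left_mono le) auto
    qed (simp add: gamma_density_def)
    then have "(\<integral>\<^sup>+x. ennreal (r * m powr (r - 1)) * ennreal (?z x powr s) \<partial>gamma_law (real n / 2)) \<le>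
        (\<integral>\<^sup>+x. ennreal (?z x powr p) + ennreal ((r - 1) * m powr r) \<partial>gamma_law (real n / 2))"
      using False by (subst (1 2) nn_integral_gamma_law) (auto intro!: nn_integral_mono)
    also have "\<dots> = (\<integral>\<^sup>+x. ennreal (?z x powr p) \<partial>gamma_law (real n / 2)) + ennreal ((r - 1) * m powr r)"
      by (subst nn_integral_add) (auto simp: g.emeasure_space_1)
    finally show ?thesis using False by simp
  qed
  have "ennreal (r * m powr (r - 1)) * ennreal m =
      (\<integral>\<^sup>+n. \<integral>\<^sup>+x. ennreal (r * m powr (r - 1)) * ennreal (?z x powr s) \<partial>gamma_law (real n / 2) \<partial>?bin)"
    unfolding m_def nn_integral_binomial_gamma_powr[OF q s, symmetric]
    by (simp add: nn_integral_cmult)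
  also have "\<dots> \<le> (\<integral>\<^sup>+n. (\<integral>\<^sup>+x. ennreal (?z x powr p) \<partial>gamma_law (real n / 2)) +
      ennreal ((r - 1) * m powr r) * indicator {1..} n \<partial>?bin)"
    by (intro nn_integral_mono inner)
  also have "\<dots> = ennreal (I0q q p d) + ennreal ((r - 1) * m powr r) * emeasure ?bin {1..}"
    using s p by (subst nn_integral_add) (auto simp only: nn_integral_binomial_gamma_powr[OF q order.strict_trans[OF s p]]
        nn_integral_cmult_indicator sets_measure_pmf UNIV_I measurable_measure_pmf space_count_space, auto)
  also have "emeasure ?bin {1..} = ennreal (1 - a)"
  proof -
    have "{1..} = UNIV - {0::nat}" by auto
    then have "measure ?bin {1..} = 1 - pmf (binomial_pmf d (q / 2)) 0"
      using measure_pmf.prob_compl[of "{0}" "binomial_pmf d (q / 2)"] by (simp add: pmf.rep_eq)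
    also have "\<dots> = 1 - a" using q by (simp add: a_def)
    finally show ?thesis by (simp add: measure_pmf.emeasure_eq_measure)
  qed
  also have "ennreal (I0q q p d) + ennreal ((r - 1) * m powr r) * ennreal (1 - a) =
      ennreal (I0q q p d + (r - 1) * m powr r * (1 - a))"
    using Ip r a by (simp add: ennreal_mult' [symmetric] ennreal_plus [symmetric] del: ennreal_plus)
  finally have "r * m powr (r - 1) * m \<le> I0q q p d + (r - 1) * m powr r * (1 - a)"
    using Ip r a m by (simp add: ennreal_mult' [symmetric] ennreal_le_iff add_nonneg_nonneg del: ennreal_plus)
  moreover have "r * m powr (r - 1) * m = r * m powr r"
    using m by (simp add: powr_diff)
  \<comment> \<open>After cancellation, the surplus over Jensen's inequality is the tangent constant
    times the mass \<open>a\<close> of the atom.\<close>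
  ultimately have "m powr r + (r - 1) * m powr r * a \<le> I0q q p d"
    by (simp add: left_diff_distrib right_diff_distrib)
  moreover have "0 < (r - 1) * m powr r * a"
    using r m a by simp
  ultimately show ?thesis by (simp add: m_def r_def)
qed

section \<open>Peeling off the first layer\<close>

lemma net_state_case_nat:
  "net_state x0 (case_nat w \<omega>) (Suc k) = net_state (relu_layer x0 w) \<omega> k"
  by (induction k) (simp_all add: relu_layer_def)

lemma measurable_net_state [measurable]:
  "(\<lambda>\<omega>. net_state x0 \<omega> k $ i) \<in> borel_measurable (net_space \<sigma> q)"
proof (induction k arbitrary: i)
  case 0
  then show ?case by simp
next
  case (Suc k)
  note [measurable] = Suc
  have component: "(\<lambda>\<omega>. \<omega> k) \<in> net_space \<sigma> q \<rightarrow>\<^sub>M layer_space \<sigma> q"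
    unfolding net_space_def by measurable
  note [measurable] = measurable_compose[OF component measurable_layer_weight]
    measurable_compose[OF component measurable_layer_dropout]
  show ?case by simp
qed

lemma measurable_norm_net_state [measurable]:
  "(\<lambda>\<omega>. norm (net_state x0 \<omega> k)) \<in> borel_measurable (net_space \<sigma> q)"
  unfolding norm_vec_def L2_set_def by simp

text \<open>An i.i.d. sequence is an independent first layer followed by a copy of the whole
  sequence. Conditioning on that layer leaves a network with one layer fewer, started from its
  output.\<close>

lemma moment_Suc:
  fixes x0 :: "real^'d::finite"
  assumes "0 < \<sigma>"
  shows "moment \<sigma> q x0 s (Suc k) = (\<integral>\<^sup>+w. moment \<sigma> q (relu_layer x0 w) s k \<partial>layer_space \<sigma> q)"
proof -
  let ?L = "layer_space \<sigma> q :: (('d \<times> 'd \<Rightarrow> real) \<times> ('d \<Rightarrow> real)) measure"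
  let ?S = "net_space \<sigma> q :: (nat \<Rightarrow> ('d \<times> 'd \<Rightarrow> real) \<times> ('d \<Rightarrow> real)) measure"
  let ?f = "\<lambda>\<omega>. ennreal (norm (net_state x0 \<omega> (Suc k)) powr s)"
  interpret L: prob_space ?L by (rule prob_space_layer_space) fact
  interpret sequence_space ?L by standard
  interpret S: prob_space ?S
    unfolding net_space_def by (intro prob_space_PiM L.prob_space_axioms)
  have [measurable]: "(\<lambda>(w, \<omega>). case_nat w \<omega>) \<in> ?L \<Otimes>\<^sub>M ?S \<rightarrow>\<^sub>M ?S"
    unfolding net_space_def by measurable
  have "moment \<sigma> q x0 s (Suc k) = (\<integral>\<^sup>+\<omega>. ?f \<omega> \<partial>distr (?L \<Otimes>\<^sub>M ?S) ?S (\<lambda>(w, \<omega>). case_nat w \<omega>))"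
    unfolding moment_def using PiM_iter by (simp only: net_space_def)
  also have "\<dots> = (\<integral>\<^sup>+p. ?f ((\<lambda>(w, \<omega>). case_nat w \<omega>) p) \<partial>(?L \<Otimes>\<^sub>M ?S))"
    by (rule nn_integral_distr) measurable
  also have "\<dots> = (\<integral>\<^sup>+w. \<integral>\<^sup>+\<omega>. ?f ((\<lambda>(w, \<omega>). case_nat w \<omega>) (w, \<omega>)) \<partial>?S \<partial>?L)"
    by (rule S.nn_integral_fst[symmetric]) measurable
  also have "\<dots> = (\<integral>\<^sup>+w. moment \<sigma> q (relu_layer x0 w) s k \<partial>?L)"
    unfolding moment_def prod.case net_state_case_nat ..
  finally show ?thesis .
qed

text \<open>Induction on the depth for all starting vectors: given the first layer, the remaining
  moment is a constant times a power of the norm of its output, and the mean of that power supplies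
  one more factor.\<close>

lemma moment_eq:
  fixes x0 :: "real^'d::finite"
  assumes q: "0 < q" "q \<le> 1" and s: "0 < s" and \<sigma>: "0 < \<sigma>"
  shows "moment \<sigma> q x0 s k = ennreal (norm x0 powr s * (\<sigma> powr s * I0q q s CARD('d)) ^ k)"
proof (induction k arbitrary: x0)
  case 0
  interpret L: prob_space "layer_space \<sigma> q :: (('d \<times> 'd \<Rightarrow> real) \<times> ('d \<Rightarrow> real)) measure"
    by (rule prob_space_layer_space) fact
  interpret S: prob_space "net_space \<sigma> q :: (nat \<Rightarrow> ('d \<times> 'd \<Rightarrow> real) \<times> ('d \<Rightarrow> real)) measure"
    unfolding net_space_def by (intro prob_space_PiM L.prob_space_axioms)
  show ?case by (simp add: moment_def S.emeasure_space_1)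
next
  case (Suc k)
  let ?A = "\<sigma> powr s * I0q q s CARD('d)"
  have A: "0 \<le> ?A" using I0q_pos[OF q s, of "CARD('d)"] by simp
  have "moment \<sigma> q x0 s (Suc k) =
      (\<integral>\<^sup>+w. ennreal (norm (relu_layer x0 w) powr s) * ennreal (?A ^ k) \<partial>layer_space \<sigma> q)"
    unfolding moment_Suc[OF \<sigma>] Suc using A by (simp add: ennreal_mult)
  also have "\<dots> = (\<integral>\<^sup>+w. ennreal (norm (relu_layer x0 w) powr s) \<partial>layer_space \<sigma> q) * ennreal (?A ^ k)"
    by (rule nn_integral_multc) measurable
  also have "\<dots> = ennreal (norm x0 powr s * ?A) * ennreal (?A ^ k)"
    by (simp only: nn_integral_norm_relu_layer_powr[OF q s \<sigma>])
  also have "\<dots> = ennreal (norm x0 powr s * ?A ^ Suc k)"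
    using A by (simp add: ennreal_mult [symmetric] mult.assoc)
  finally show ?case .
qed

section \<open>Growth, decay and the critical variance\<close>

lemma tendsto_ennreal_geometric_infinity:
  assumes "0 < c" "1 < r"
  shows "(\<lambda>k. ennreal (c * r ^ k)) \<longlonglongrightarrow> \<infinity>"
proof -
  have "filterlim (\<lambda>k. r ^ k) at_top sequentially"
    using assms filterlim_realpow_sequentially_gt1[of r]
    by (simp add: filterlim_at_infinity_imp_filterlim_at_top)
  then have "filterlim (\<lambda>k. c * r ^ k) at_top sequentially"
    using assms by (intro filterlim_tendsto_pos_mult_at_top[OF tendsto_const])
  then show ?thesis
    by (simp add: ennreal_tendsto_top_eq_at_top)
qed

text \<open>\<open>sigma_bar\<close> is the positive solution of
  \<open>\<sigma> powr s * I0q q s d = 1\<close>, whose left side is strictly increasing in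
  \<sigma>.\<close>

lemma powr_mult_compare_sigma_bar:
  assumes s: "0 < s" and \<sigma>: "0 < \<sigma>" and I: "0 < I0q q s d"
  shows "\<sigma> = sigma_bar q s d \<Longrightarrow> \<sigma> powr s * I0q q s d = 1"
    and "\<sigma> < sigma_bar q s d \<Longrightarrow> \<sigma> powr s * I0q q s d < 1"
    and "\<sigma> > sigma_bar q s d \<Longrightarrow> \<sigma> powr s * I0q q s d > 1"
proof -
  have b: "sigma_bar q s d powr s = 1 / I0q q s d"
    unfolding sigma_bar_def powr_powr using s I by (simp add: powr_minus_divide)
  have b0: "0 < sigma_bar q s d" using I by (simp add: sigma_bar_def)
  show "\<sigma> = sigma_bar q s d \<Longrightarrow> \<sigma> powr s * I0q q s d = 1"
    using b I by simp
  show "\<sigma> < sigma_bar q s d \<Longrightarrow> \<sigma> powr s * I0q q s d < 1"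
    using b I powr_less_mono2[OF s, of \<sigma> "sigma_bar q s d"] \<sigma> by (simp add: pos_less_divide_eq)
  show "\<sigma> > sigma_bar q s d \<Longrightarrow> \<sigma> powr s * I0q q s d > 1"
    using b b0 I powr_less_mono2[OF s, of "sigma_bar q s d" \<sigma>] by (simp add: pos_divide_less_eq)
qed

theorem mainTheorem10:
  fixes x0 :: "real^'d::finite" and \<sigma> q s :: real
  assumes "0 < q" and "q \<le> 1" and "0 < s" and "0 < \<sigma>"
  shows "(\<forall>k. moment \<sigma> q x0 s k =
            ennreal (norm x0 powr s * (\<sigma> powr s * I0q q s CARD('d)) ^ k))
    \<and> (x0 \<noteq> 0 \<longrightarrow>
        (\<sigma> = sigma_bar q s CARD('d) \<longrightarrow>
            (\<forall>k\<ge>1. moment \<sigma> q x0 s k = ennreal (norm x0 powr s))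
          \<and> (\<forall>p>s. (moment \<sigma> q x0 p \<longlonglongrightarrow> \<infinity>) \<and>
                (\<exists>c>0. \<exists>r>1. \<forall>k. ennreal (c * r ^ k) \<le> moment \<sigma> q x0 p k)))
      \<and> (\<sigma> < sigma_bar q s CARD('d) \<longrightarrow>
            (moment \<sigma> q x0 s \<longlonglongrightarrow> 0) \<and>
            (\<exists>C r. 0 < r \<and> r < 1 \<and> (\<forall>k. moment \<sigma> q x0 s k \<le> ennreal (C * r ^ k))))
      \<and> (\<sigma> > sigma_bar q s CARD('d) \<longrightarrow>
            (moment \<sigma> q x0 s \<longlonglongrightarrow> \<infinity>) \<and>
            (\<exists>c>0. \<exists>r>1. \<forall>k. ennreal (c * r ^ k) \<le> moment \<sigma> q x0 s k)))"
proof -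
  let ?I = "\<lambda>t. I0q q t CARD('d)"
  have I: "0 < ?I t" if "0 < t" for t
    using that assms by (intro I0q_pos) auto
  have eq: "moment \<sigma> q x0 t = (\<lambda>k. ennreal (norm x0 powr t * (\<sigma> powr t * ?I t) ^ k))" if "0 < t" for t
    using that assms by (intro ext moment_eq) auto
  note compare = powr_mult_compare_sigma_bar[OF assms(3,4) I[OF assms(3)]]
  \<comment> \<open>The exponent \<open>t\<close> is kept general because the claim serves
    \<open>t = s\<close> above the critical value and \<open>t = p > s\<close> at it. The geometric
    lower bound is attained with equality.\<close>
  have growth: "(moment \<sigma> q x0 t \<longlonglongrightarrow> \<infinity>) \<and>
      (\<exists>c>0. \<exists>r>1. \<forall>k. ennreal (c * r ^ k) \<le> moment \<sigma> q x0 t k)"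
    if "x0 \<noteq> 0" "0 < t" "1 < \<sigma> powr t * ?I t" for t
  proof (intro conjI exI)
    show "moment \<sigma> q x0 t \<longlonglongrightarrow> \<infinity>"
      unfolding eq[OF that(2)] using that by (intro tendsto_ennreal_geometric_infinity) auto
    show "0 < norm x0 powr t" using that by simp
    show "1 < \<sigma> powr t * ?I t" by fact
    show "\<forall>k. ennreal (norm x0 powr t * (\<sigma> powr t * ?I t) ^ k) \<le> moment \<sigma> q x0 t k"
      by (simp add: eq[OF that(2)])
  qed
  have decay: "(moment \<sigma> q x0 s \<longlonglongrightarrow> 0) \<and>
      (\<exists>C r. 0 < r \<and> r < 1 \<and> (\<forall>k. moment \<sigma> q x0 s k \<le> ennreal (C * r ^ k)))"
    if lt: "\<sigma> powr s * ?I s < 1"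
  proof (intro conjI exI)
    show pos: "0 < \<sigma> powr s * ?I s" using I assms by simp
    show "\<sigma> powr s * ?I s < 1" by fact
    have "(\<lambda>k. norm x0 powr s * (\<sigma> powr s * ?I s) ^ k) \<longlonglongrightarrow> norm x0 powr s * 0"
      using pos lt by (intro tendsto_mult tendsto_const LIMSEQ_power_zero) simp
    from tendsto_ennrealI[OF this] show "moment \<sigma> q x0 s \<longlonglongrightarrow> 0"
      by (simp add: eq[OF assms(3)])
    show "\<forall>k. moment \<sigma> q x0 s k \<le> ennreal (norm x0 powr s * (\<sigma> powr s * ?I s) ^ k)"
      by (simp add: eq[OF assms(3)])
  qed
  \<comment> \<open>Raising the critical equation to the power \<open>p / s\<close> gives
    \<open>\<sigma> powr p * ?I s powr (p / s) = 1\<close>; the strict Lyapunov inequality then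
    pushes the factor for \<open>p\<close> above 1.\<close>
  have critical: "1 < \<sigma> powr p * ?I p" if "\<sigma> = sigma_bar q s CARD('d)" "s < p" for p
  proof -
    have "\<sigma> powr p * ?I s powr (p / s) = (\<sigma> powr s * ?I s) powr (p / s)"
      using assms I by (simp add: powr_mult powr_powr)
    also have "\<dots> = 1" using compare(1)[OF that(1)] by simp
    finally have "1 = \<sigma> powr p * ?I s powr (p / s)" by simp
    also have "\<dots> < \<sigma> powr p * ?I p"
      using assms that by (intro mult_strict_left_mono I0q_powr_less) auto
    finally show ?thesis .
  qed
  show ?thesis
  proof (intro conjI[OF _ impI] conjI impI)
    show "\<forall>k. moment \<sigma> q x0 s k = ennreal (norm x0 powr s * (\<sigma> powr s * ?I s) ^ k)"
      by (simp add: eq[OF assms(3)])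
  next
    assume "\<sigma> = sigma_bar q s CARD('d)"
    from compare(1)[OF this] show "\<forall>k\<ge>1. moment \<sigma> q x0 s k = ennreal (norm x0 powr s)"
      by (simp only: eq[OF assms(3)]) simp
  next
    assume "x0 \<noteq> 0" "\<sigma> = sigma_bar q s CARD('d)"
    then show "\<forall>p>s. (moment \<sigma> q x0 p \<longlonglongrightarrow> \<infinity>) \<and>
        (\<exists>c>0. \<exists>r>1. \<forall>k. ennreal (c * r ^ k) \<le> moment \<sigma> q x0 p k)"
      using growth critical assms(3) by (meson order.strict_trans)
  qed (use growth[OF _ assms(3)] decay compare in blast)+
qed

end
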